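(* Let $S$ be a nonempty commutative semigroup, let $G$ be a group, and let $f,f':S\to G$ be polynomial maps of degree $\le d$ and $\le d'$ respectively. If the subgroup $\langle f,f'\rangle$ of $G$ generated by $f(S)\cup f'(S)$ is nilpotent, then the elementwise product $ff':S\to G$, $t\mapsto f(t)f'(t)$, is a polynomial map.
   Context: Let $S$ be a nonempty commutative semigroup (written additively) and $G$ a group with identity $1_G$. A map $f:S\to G$ is a polynomial map of degree $-\infty$ if $f(s)=1_G$ for all $s$, and of degree $0$ if it is constant with value different from $1_G$. Thus degree $\le 0$ means constant. Inductively, for $d\in\{0,1,2,\dots\}$, $f$ is a polynomial map of degree $\le d+1$ if for every $s\in S$ both maps $L_s(f):t\mapsto f(s+t)f(t)^{-1}$ and $R_s(f):t\mapsto f(t)^{-1}f(s+t)$ from $S$ to $G$ are polynomial maps of degree $\le d$. The degree of a polynomial map is the least such $d\in\{-\infty,0,1,2,\dots\}$. A map is a polynomial map if it is a polynomial map of degree $\le d$ for some $d$. *)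

theory Defs
  imports "HOL-Algebra.Generated_Groups"
begin

text \<open>
  A degree bound is an element of \<open>{-\<infinity>} \<union> {0, 1, 2, \<dots>}\<close>; \<open>MInfty\<close> is \<open>-\<infinity>\<close>.
\<close>

datatype degree_bound = MInfty | Deg nat

definition left_diff ::
  "('g, 'm) monoid_scheme \<Rightarrow> 's::plus \<Rightarrow> ('s \<Rightarrow> 'g) \<Rightarrow> 's \<Rightarrow> 'g"
  where "left_diff G s f = (\<lambda>t. f (s + t) \<otimes>\<^bsub>G\<^esub> inv\<^bsub>G\<^esub> (f t))"

definition right_diff ::
  "('g, 'm) monoid_scheme \<Rightarrow> 's::plus \<Rightarrow> ('s \<Rightarrow> 'g) \<Rightarrow> 's \<Rightarrow> 'g"
  where "right_diff G s f = (\<lambda>t. inv\<^bsub>G\<^esub> (f t) \<otimes>\<^bsub>G\<^esub> f (s + t))"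

text \<open>
  \<open>poly_map_le G d f\<close>: \<open>f\<close> maps the whole semigroup (the type \<open>'s\<close>) into \<open>carrier G\<close> and is
  a polynomial map of degree \<open>\<le> d\<close>. Degree \<open>\<le> 0\<close> means constant, the constant \<open>\<one>\<close>
  (degree \<open>-\<infinity>\<close>) included.
\<close>

primrec poly_map_le_nat ::
  "('g, 'm) monoid_scheme \<Rightarrow> nat \<Rightarrow> ('s::ab_semigroup_add \<Rightarrow> 'g) \<Rightarrow> bool"
  where
    "poly_map_le_nat G 0 = (\<lambda>f. \<exists>c. \<forall>s. f s = c)"
  | "poly_map_le_nat G (Suc d) = (\<lambda>f. \<forall>s.
       poly_map_le_nat G d (left_diff G s f) \<and> poly_map_le_nat G d (right_diff G s f))"

definition poly_map_le ::
  "('g, 'm) monoid_scheme \<Rightarrow> degree_bound \<Rightarrow> ('s::ab_semigroup_add \<Rightarrow> 'g) \<Rightarrow> bool"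
  where "poly_map_le G d f \<longleftrightarrow> f \<in> UNIV \<rightarrow> carrier G \<and>
    (case d of MInfty \<Rightarrow> (\<forall>s. f s = \<one>\<^bsub>G\<^esub>) | Deg n \<Rightarrow> poly_map_le_nat G n f)"

definition poly_map :: "('g, 'm) monoid_scheme \<Rightarrow> ('s::ab_semigroup_add \<Rightarrow> 'g) \<Rightarrow> bool"
  where "poly_map G f \<longleftrightarrow> (\<exists>d. poly_map_le G d f)"

primrec lower_central :: "('g, 'm) monoid_scheme \<Rightarrow> nat \<Rightarrow> 'g set"
  where
    "lower_central G 0 = carrier G"
  | "lower_central G (Suc n) = generate G
       (\<Union>x \<in> lower_central G n. \<Union>y \<in> carrier G.
          {x \<otimes>\<^bsub>G\<^esub> y \<otimes>\<^bsub>G\<^esub> inv\<^bsub>G\<^esub> x \<otimes>\<^bsub>G\<^esub> inv\<^bsub>G\<^esub> y})"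

definition nilpotent_group :: "('g, 'm) monoid_scheme \<Rightarrow> bool"
  where "nilpotent_group G \<longleftrightarrow> group G \<and> (\<exists>n. lower_central G n = {\<one>\<^bsub>G\<^esub>})"

end

theory Submission
  imports Defs
begin

text \<open>
  The product rule \<open>L\<^sub>s (f g) = L\<^sub>s f \<cdot> [f, L\<^sub>s g] \<cdot> L\<^sub>s g\<close> shows what has to be controlled: the
  commutator \<open>[f, L\<^sub>s g]\<close> need not have smaller degree than \<open>f g\<close>. In a nilpotent group, however,
  it is smaller in another sense, because its values lie deeper in the lower central series.
  A filtration \<open>H 0 \<supseteq> H 1 \<supseteq> \<dots>\<close> with \<open>[H i, H j] \<subseteq> H (i + j)\<close> measures both effects
  together: a map is filtered-polynomial of level \<open>k\<close> if its values lie in \<open>H k\<close> and its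
  \<open>n\<close>-fold differences have values in \<open>H (k + n)\<close> (\<open>filtered_poly\<close>).

  The theorem of Lazard and Leibman says that such maps form a group
  (\<open>filtered_poly_mult\<close>). Instead of proving closure under products and under commutators by a
  simultaneous induction, the proof adjoins all products, inverses and commutators at once
  (\<open>poly_closure\<close>) and shows that differences of members of level \<open>k\<close> are members of level
  \<open>Suc k\<close> (\<open>poly_closure_left_diff\<close>). By coinduction the adjunction has added nothing.

  Write \<open>\<gamma> 0 = G\<close>, \<open>\<gamma> (Suc n) = [\<gamma> n, G]\<close>. A map of degree at most \<open>D > 0\<close> is filtered-polynomial
  of level 0 for the lower central series slowed down by the factor \<open>D\<close>, that is
  \<open>H i = \<gamma> ((i - 1) div D)\<close>: its first \<open>D\<close> differences only have to lie in \<open>G\<close>, the others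
  are trivial. This is a filtration by \<open>[\<gamma> i, \<gamma> j] \<subseteq> \<gamma> (Suc (i + j))\<close>
  (\<open>lower_central_commutator\<close>), which follows from the Hall--Witt identity. If \<open>\<gamma> c\<close> is trivial
  then so is \<open>H (Suc (D * c))\<close>, so the product of two such maps, being filtered-polynomial,
  has bounded degree (\<open>poly_map_le_nat_mult_nilpotent\<close>). The theorem applies this inside
  the subgroup generated by the values of the two maps.
\<close>

section \<open>Commutator identities\<close>

context group
begin

definition commutator :: "'a \<Rightarrow> 'a \<Rightarrow> 'a"
  where "commutator x y = x \<otimes> y \<otimes> inv x \<otimes> inv y"

lemma commutator_closed [simp]:
  "x \<in> carrier G \<Longrightarrow> y \<in> carrier G \<Longrightarrow> commutator x y \<in> carrier G"
  by (simp add: commutator_def)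

lemma cancel_inv_left:
  "x \<in> carrier G \<Longrightarrow> y \<in> carrier G \<Longrightarrow> inv x \<otimes> (x \<otimes> y) = y"
  "x \<in> carrier G \<Longrightarrow> y \<in> carrier G \<Longrightarrow> x \<otimes> (inv x \<otimes> y) = y"
  by (simp_all flip: m_assoc)

text \<open>
  A normal form for group words, which decides the identities below: words are associated to
  the right, inverses are pushed to the letters, and adjacent inverse letters cancel.
\<close>

lemmas word_simps = m_assoc inv_mult_group cancel_inv_left

lemma between_cancel:
  assumes "a \<in> carrier G" "b \<in> carrier G" "c \<in> carrier G"
  shows "b = inv a \<otimes> (a \<otimes> b \<otimes> c) \<otimes> inv c"
  using assms by (simp add: word_simps)

lemma cancel_conj:
  "g \<in> carrier G \<Longrightarrow> x \<in> carrier G \<Longrightarrow> inv g \<otimes> (g \<otimes> x \<otimes> inv g) \<otimes> g = x"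
  by (simp add: word_simps)

lemma inv_commutator:
  assumes "x \<in> carrier G" "y \<in> carrier G"
  shows "inv (commutator x y) = commutator y x"
  using assms by (simp add: commutator_def word_simps)

lemma commutator_conj:
  assumes "x \<in> carrier G" "y \<in> carrier G" "g \<in> carrier G"
  shows "g \<otimes> commutator x y \<otimes> inv g = commutator (g \<otimes> x \<otimes> inv g) (g \<otimes> y \<otimes> inv g)"
  using assms by (simp add: commutator_def word_simps)

lemma commutator_mult_right:
  assumes "x \<in> carrier G" "y \<in> carrier G" "z \<in> carrier G"
  shows "commutator x (y \<otimes> z) = commutator x y \<otimes> (y \<otimes> commutator x z \<otimes> inv y)"
  using assms by (simp add: commutator_def word_simps)

lemma commutator_inv_right:
  assumes "x \<in> carrier G" "y \<in> carrier G"
  shows "commutator x (inv y) = inv y \<otimes> inv (commutator x y) \<otimes> y"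
  using assms by (simp add: commutator_def word_simps)

lemma Hall_Witt:
  assumes "x \<in> carrier G" "y \<in> carrier G" "z \<in> carrier G"
  shows "(x \<otimes> commutator y (commutator (inv x) z) \<otimes> inv x)
    \<otimes> (z \<otimes> commutator x (commutator (inv z) y) \<otimes> inv z)
    \<otimes> (y \<otimes> commutator z (commutator (inv y) x) \<otimes> inv y) = \<one>"
  using assms by (simp add: commutator_def word_simps)

text \<open>
  With \<open>u = L\<^sub>s f\<close> and \<open>v = L\<^sub>s g\<close>, the left-hand side is the left difference of \<open>[f, g]\<close>.
  The shape of the right-hand side is what matters: it is a product of commutators,
  each of which involves \<open>u\<close> or \<open>v\<close> and so gains a level over \<open>[f, g]\<close>. No conjugates are left;
  they are rewritten as products with commutators.
\<close>

lemma commutator_mult_mult: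
  assumes [simp]: "u \<in> carrier G" "f \<in> carrier G" "v \<in> carrier G" "g \<in> carrier G"
  shows "commutator (u \<otimes> f) (v \<otimes> g) \<otimes> inv (commutator f g) =
    commutator u (commutator f v) \<otimes> (commutator f v \<otimes>
     (commutator (u \<otimes> v) (commutator f g) \<otimes>
     (commutator (commutator f g) (commutator u (v \<otimes> g)) \<otimes> commutator u (v \<otimes> g))))"
  by (simp add: commutator_def word_simps)

end

section \<open>The lower central series is a filtration\<close>

context group
begin

lemma lower_central_Suc:
  "lower_central G (Suc n) =
     generate G (\<Union>x\<in>lower_central G n. \<Union>y\<in>carrier G. {commutator x y})"
  by (simp add: commutator_def)

lemma lower_central_normal: "lower_central G n \<lhd> G"
proof (induction n)
  case 0
  show ?case by (simp add: normal_inv_iff subgroup_self)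
next
  case (Suc n)
  interpret N: normal "lower_central G n" G by (fact Suc)
  show ?case
    unfolding lower_central_Suc
  proof (rule normal_generateI)
    show "(\<Union>x\<in>lower_central G n. \<Union>y\<in>carrier G. {commutator x y}) \<subseteq> carrier G"
      using N.subset by auto
  next
    fix h g
    assume "h \<in> (\<Union>x\<in>lower_central G n. \<Union>y\<in>carrier G. {commutator x y})" and g: "g \<in> carrier G"
    then obtain x y where x: "x \<in> lower_central G n" and y: "y \<in> carrier G"
      and h: "h = commutator x y" by blast
    have "g \<otimes> h \<otimes> inv g = commutator (g \<otimes> x \<otimes> inv g) (g \<otimes> y \<otimes> inv g)"
      unfolding h using x y g N.subset by (intro commutator_conj) auto
    moreover have "g \<otimes> x \<otimes> inv g \<in> lower_central G n" using g x by (rule N.inv_op_closed2)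
    ultimately show "g \<otimes> h \<otimes> inv g \<in> (\<Union>x\<in>lower_central G n. \<Union>y\<in>carrier G. {commutator x y})"
      using g y by blast
  qed
qed

lemma lower_central_subgroup: "subgroup (lower_central G n) G"
  by (rule normal_imp_subgroup[OF lower_central_normal])

lemma lower_central_carrier: "x \<in> lower_central G n \<Longrightarrow> x \<in> carrier G"
  by (rule subgroup.mem_carrier[OF lower_central_subgroup])

lemma lower_central_Suc_subset: "lower_central G (Suc n) \<subseteq> lower_central G n"
proof -
  interpret N: normal "lower_central G n" G by (fact lower_central_normal)
  have "commutator x y \<in> lower_central G n" if "x \<in> lower_central G n" "y \<in> carrier G" for x y
  proof -
    have "x \<otimes> (y \<otimes> inv x \<otimes> inv y) \<in> lower_central G n"
      using that by (intro N.m_closed N.inv_op_closed2 N.m_inv_closed)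
    then show ?thesis using that N.mem_carrier by (simp add: commutator_def m_assoc)
  qed
  then show ?thesis
    unfolding lower_central_Suc by (intro generate_subgroup_incl N.subgroup_axioms) auto
qed

lemma lower_central_antimono: "m \<le> n \<Longrightarrow> lower_central G n \<subseteq> lower_central G m"
  by (rule lift_Suc_antimono_le[of "lower_central G"]) (rule lower_central_Suc_subset)

text \<open>
  This is the three subgroups lemma for \<open>\<gamma> i\<close>, \<open>\<gamma> j\<close> and \<open>G\<close>. For a generator \<open>[b, g]\<close> of
  \<open>\<gamma> (Suc j)\<close>, the Hall--Witt identity expresses a conjugate of \<open>[x, [g, b]]\<close> by
  conjugates of double commutators whose inner commutators are \<open>[inv x, inv g]\<close> and \<open>[inv b, x]\<close>,
  and the induction hypothesis for \<open>j\<close> covers both, since \<open>i\<close> is arbitrary.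
  The elements \<open>a\<close> with \<open>[\<gamma> i, a] \<subseteq> \<gamma> (Suc (i + Suc j))\<close> form a subgroup because the
  target is normal, so generators suffice.
\<close>

lemma lower_central_commutator:
  assumes "x \<in> lower_central G i" "y \<in> lower_central G j"
  shows "commutator x y \<in> lower_central G (Suc (i + j))"
  using assms
proof (induction j arbitrary: i x y)
  case 0
  then show ?case by (auto simp: lower_central_Suc simp del: lower_central.simps(2) intro: generate.incl)
next
  case (Suc j)
  define K where "K = lower_central G (Suc (i + Suc j))"
  interpret N: normal K G unfolding K_def by (fact lower_central_normal)
  have flip: "commutator b a \<in> lower_central G n"
    if "commutator a b \<in> lower_central G n" "a \<in> carrier G" "b \<in> carrier G" for a b n
    using subgroup.m_inv_closed[OF lower_central_subgroup that(1)] that by (simp add: inv_commutator)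
  have conj: "g \<otimes> k \<otimes> inv g \<in> K" if "g \<in> carrier G" "k \<in> K" for g k
    using that by (rule N.inv_op_closed2)
  have inv_right: "commutator x (inv a) \<in> K"
    if "commutator x a \<in> K" "x \<in> carrier G" "a \<in> carrier G" for x a
    unfolding commutator_inv_right[OF that(2,3)] using that by (intro N.inv_op_closed1 N.m_inv_closed)
  have swapped: "commutator x (commutator g b) \<in> K"
    if x: "x \<in> lower_central G i" and b: "b \<in> lower_central G j" and g: "g \<in> carrier G" for x b g
  proof -
    note xc = lower_central_carrier[OF x] and bc = lower_central_carrier[OF b]
    note ix = subgroup.m_inv_closed[OF lower_central_subgroup x]
      and ib = subgroup.m_inv_closed[OF lower_central_subgroup b]
    \<comment> \<open>\<open>Hall_Witt\<close> has \<open>inv z\<close> in the inner commutator of its middle factor, where \<open>g\<close> is wanted.\<close>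
    define z where "z = inv g"
    have z: "z \<in> carrier G" "inv z = g" using g by (auto simp: z_def)
    have "commutator (inv x) z \<in> lower_central G (Suc i)"
      using ix z by (auto simp: lower_central_Suc simp del: lower_central.simps(2) intro: generate.incl)
    from Suc.IH[OF this b] have "commutator (commutator (inv x) z) b \<in> K"
      unfolding K_def by (simp only: add_Suc add_Suc_right)
    then have 1: "commutator b (commutator (inv x) z) \<in> K"
      using xc bc z unfolding K_def by (simp add: flip del: lower_central.simps)
    have "commutator (inv b) x \<in> lower_central G (Suc (i + j))"
      using flip[OF Suc.IH[OF x ib]] xc bc by simp
    then have "commutator (commutator (inv b) x) z \<in> K"
      using z unfolding K_def add_Suc_right lower_central_Suc[of "Suc (i + j)"] by (blast intro: generate.incl)
    then have 2: "commutator z (commutator (inv b) x) \<in> K"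
      using xc bc z unfolding K_def by (simp add: flip del: lower_central.simps)
    let ?A = "x \<otimes> commutator b (commutator (inv x) z) \<otimes> inv x"
    let ?B = "z \<otimes> commutator x (commutator (inv z) b) \<otimes> inv z"
    let ?C = "b \<otimes> commutator z (commutator (inv b) x) \<otimes> inv b"
    have A: "?A \<in> K" and C: "?C \<in> K" using 1 2 xc bc by (auto intro: conj)
    have closed: "?A \<in> carrier G" "?B \<in> carrier G" "?C \<in> carrier G" using xc bc z by auto
    have "?B = inv ?A \<otimes> (?A \<otimes> ?B \<otimes> ?C) \<otimes> inv ?C" using closed by (rule between_cancel)
    also have "?A \<otimes> ?B \<otimes> ?C = \<one>" using xc bc z by (intro Hall_Witt) auto
    finally have "?B \<in> K" using A C by (metis N.m_closed N.m_inv_closed N.one_closed)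
    then have "inv z \<otimes> ?B \<otimes> z \<in> K" using z by (intro N.inv_op_closed1)
    also have "inv z \<otimes> ?B \<otimes> z = commutator x (commutator (inv z) b)"
      using xc bc z by (intro cancel_conj) auto
    finally show ?thesis by (simp only: z)
  qed
  have gen: "commutator x a \<in> K"
    if x: "x \<in> lower_central G i" and a: "a \<in> (\<Union>x\<in>lower_central G j. \<Union>y\<in>carrier G. {commutator x y})" for x a
  proof -
    from a obtain b g where b: "b \<in> lower_central G j" and g: "g \<in> carrier G" and "a = commutator b g" by blast
    note xc = lower_central_carrier[OF x] and bc = lower_central_carrier[OF b]
    have a: "a = inv (commutator g b)" unfolding \<open>a = commutator b g\<close> using bc g by (simp add: inv_commutator)
    show ?thesis unfolding a by (intro inv_right swapped commutator_closed x xc b bc g)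
  qed
  have gens_carrier: "(\<Union>x\<in>lower_central G j. \<Union>y\<in>carrier G. {commutator x y}) \<subseteq> carrier G"
    using lower_central_carrier[of _ j] by auto
  have "a \<in> carrier G \<and> (\<forall>x\<in>lower_central G i. commutator x a \<in> K)"
    if "a \<in> generate G (\<Union>x\<in>lower_central G j. \<Union>y\<in>carrier G. {commutator x y})" for a
    using that
  proof (induction rule: generate.induct)
    case one
    have "commutator x \<one> \<in> K" if "x \<in> lower_central G i" for x
      using lower_central_carrier[OF that] N.one_closed by (simp add: commutator_def)
    then show ?case by blast
  next
    case (incl h)
    then show ?case using gen gens_carrier by blast
  next
    case (inv h)
    then have "h \<in> carrier G" using gens_carrier by blast
    moreover have "commutator x (inv h) \<in> K" if "x \<in> lower_central G i" for x
      using gen[OF that inv] lower_central_carrier[OF that] \<open>h \<in> carrier G\<close> by (rule inv_right)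
    ultimately show ?case by blast
  next
    case (eng a b)
    have "commutator x (a \<otimes> b) \<in> K" if "x \<in> lower_central G i" for x
      using eng that lower_central_carrier[OF that]
      by (simp add: commutator_mult_right conj N.m_closed del: lower_central.simps)
    with eng show ?case by blast
  qed
  from this[OF Suc.prems(2)[unfolded lower_central_Suc]] Suc.prems(1)
  show ?case unfolding K_def by blast
qed

end

section \<open>Polynomial maps into a filtered group\<close>

locale filtered_group = group +
  fixes H :: "nat \<Rightarrow> 'a set"
  assumes H_subgroup: "subgroup (H i) G"
    and H_antimono: "i \<le> j \<Longrightarrow> H j \<subseteq> H i"
    and H_commutator: "x \<in> H i \<Longrightarrow> y \<in> H j \<Longrightarrow> commutator x y \<in> H (i + j)"
begin

text \<open>
  The greatest fixed point makes this a condition on the differences of all orders. A least fixed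
  point would be empty, as the unfolding never reaches a base case.
\<close>

coinductive filtered_poly :: "nat \<Rightarrow> ('s::plus \<Rightarrow> 'a) \<Rightarrow> bool" where
  "\<lbrakk>\<And>t. f t \<in> H k; \<And>s. filtered_poly (Suc k) (left_diff G s f);
    \<And>s. filtered_poly (Suc k) (right_diff G s f)\<rbrakk> \<Longrightarrow> filtered_poly k f"

text \<open>
  Commutators are a separate rule, although they are products of \<open>f\<close>, \<open>g\<close> and their inverses,
  because the product rule would only give them the smaller of the levels \<open>i\<close> and \<open>j\<close>.
\<close>

inductive poly_closure :: "nat \<Rightarrow> ('s::plus \<Rightarrow> 'a) \<Rightarrow> bool" where
  base: "filtered_poly k f \<Longrightarrow> poly_closure k f"
| weaken: "poly_closure k f \<Longrightarrow> j \<le> k \<Longrightarrow> poly_closure j f"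
| mult: "poly_closure k f \<Longrightarrow> poly_closure k g \<Longrightarrow> poly_closure k (\<lambda>t. f t \<otimes> g t)"
| inv: "poly_closure k f \<Longrightarrow> poly_closure k (\<lambda>t. inv (f t))"
| comm: "poly_closure i f \<Longrightarrow> poly_closure j g \<Longrightarrow> poly_closure (i + j) (\<lambda>t. commutator (f t) (g t))"

lemma poly_closure_values: "poly_closure k f \<Longrightarrow> f t \<in> H k"
proof (induction rule: poly_closure.induct)
  case (base k f)
  then show ?case by (auto elim: filtered_poly.cases)
next
  case (weaken k f j)
  then show ?case using H_antimono by blast
next
  case (mult k f g)
  then show ?case by (simp add: H_subgroup subgroup.m_closed)
next
  case (inv k f)
  then show ?case by (simp add: H_subgroup subgroup.m_inv_closed)
next
  case (comm i f j g)
  then show ?case by (simp add: H_commutator)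
qed

lemma poly_closure_carrier: "poly_closure k f \<Longrightarrow> f t \<in> carrier G"
  using poly_closure_values subgroup.mem_carrier[OF H_subgroup] by blast

text \<open>
  The right difference is the conjugate of the left difference by \<open>inv (f t)\<close>, and a conjugate
  is a product with a commutator. Hence only left differences need the induction below.
\<close>

lemma poly_closure_right_diff:
  assumes f: "poly_closure k f" and l: "poly_closure (Suc k) (left_diff G s f)"
  shows "poly_closure (Suc k) (right_diff G s f)"
proof -
  let ?u = "left_diff G s f"
  have "right_diff G s f = (\<lambda>t. ?u t \<otimes> commutator (inv (?u t)) (inv (f t)))"
    using poly_closure_carrier[OF f]
    by (simp add: fun_eq_iff left_diff_def right_diff_def commutator_def word_simps)
  moreover have "poly_closure (Suc k + k) (\<lambda>t. commutator (inv (?u t)) (inv (f t)))"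
    by (intro poly_closure.comm poly_closure.inv f l)
  then have "poly_closure (Suc k) (\<lambda>t. commutator (inv (?u t)) (inv (f t)))"
    by (rule poly_closure.weaken) simp
  ultimately show ?thesis using poly_closure.mult[OF l] by simp
qed

text \<open>
  The interesting case is the commutator \<open>w = [f, g]\<close>: the expansion of its difference contains
  \<open>w\<close> itself, in \<open>[u v, w]\<close> and \<open>[w, [u, v g]]\<close>. An induction proving that \<open>w\<close> is
  filtered-polynomial would be circular here, whereas \<open>w\<close> belongs to the closure by definition.
\<close>

lemma poly_closure_left_diff:
  "poly_closure k f \<Longrightarrow> poly_closure (Suc k) (left_diff G s f)"
proof (induction rule: poly_closure.induct)
  case (base k f)
  then show ?case by (auto elim: filtered_poly.cases intro: poly_closure.base)
next
  case (weaken k f j)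
  then show ?case by (auto intro: poly_closure.weaken)
next
  case (mult k f g)
  let ?u = "left_diff G s f" and ?v = "left_diff G s g"
  have "left_diff G s (\<lambda>t. f t \<otimes> g t) = (\<lambda>t. ?u t \<otimes> (commutator (f t) (?v t) \<otimes> ?v t))"
    using mult.hyps[THEN poly_closure_carrier]
    by (simp add: fun_eq_iff left_diff_def commutator_def word_simps)
  moreover have "poly_closure (k + Suc k) (\<lambda>t. commutator (f t) (?v t))"
    by (intro poly_closure.comm mult)
  then have "poly_closure (Suc k) (\<lambda>t. commutator (f t) (?v t))"
    by (rule poly_closure.weaken) simp
  ultimately show ?case using mult by (auto intro: poly_closure.mult)
next
  case (inv k f)
  have "left_diff G s (\<lambda>t. inv (f t)) = (\<lambda>t. inv (right_diff G s f t))"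
    using inv.hyps[THEN poly_closure_carrier]
    by (simp add: fun_eq_iff left_diff_def right_diff_def word_simps)
  then show ?case using poly_closure_right_diff[OF inv.hyps inv.IH] by (auto intro: poly_closure.inv)
next
  case (comm i f j g)
  let ?u = "left_diff G s f" and ?v = "left_diff G s g"
  let ?w = "\<lambda>t. commutator (f t) (g t)" and ?vg = "\<lambda>t. ?v t \<otimes> g t"
  let ?k = "Suc (i + j)"
  note carrier = comm.hyps[THEN poly_closure_carrier] comm.IH[THEN poly_closure_carrier]
  have diff_w: "left_diff G s ?w = (\<lambda>t. commutator (?u t) (commutator (f t) (?v t)) \<otimes> (commutator (f t) (?v t) \<otimes>
     (commutator (?u t \<otimes> ?v t) (?w t) \<otimes>
     (commutator (?w t) (commutator (?u t) (?vg t)) \<otimes> commutator (?u t) (?vg t)))))"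
  proof
    fix t
    have "f (s + t) = ?u t \<otimes> f t" "g (s + t) = ?v t \<otimes> g t"
      using carrier by (simp_all add: left_diff_def word_simps)
    then have "left_diff G s ?w t =
      commutator (?u t \<otimes> f t) (?v t \<otimes> g t) \<otimes> inv (commutator (f t) (g t))"
      by (simp add: left_diff_def[of G s ?w])
    then show "left_diff G s ?w t = commutator (?u t) (commutator (f t) (?v t)) \<otimes> (commutator (f t) (?v t) \<otimes>
     (commutator (?u t \<otimes> ?v t) (?w t) \<otimes>
     (commutator (?w t) (commutator (?u t) (?vg t)) \<otimes> commutator (?u t) (?vg t))))"
      using carrier by (simp only: commutator_mult_mult)
  qed
  have w: "poly_closure (i + j) ?w" by (intro poly_closure.comm comm)
  have fv: "poly_closure ?k (\<lambda>t. commutator (f t) (?v t))"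
    using poly_closure.comm[OF comm.hyps(1) comm.IH(2)] by simp
  have ufv: "poly_closure ?k (\<lambda>t. commutator (?u t) (commutator (f t) (?v t)))"
    by (rule poly_closure.weaken[OF poly_closure.comm[OF comm.IH(1) fv]]) simp
  have "poly_closure 1 (\<lambda>t. ?u t \<otimes> ?v t)"
    by (intro poly_closure.mult poly_closure.weaken[OF comm.IH(1)] poly_closure.weaken[OF comm.IH(2)]) auto
  from poly_closure.comm[OF this w]
  have uvw: "poly_closure ?k (\<lambda>t. commutator (?u t \<otimes> ?v t) (?w t))" by simp
  have "poly_closure j ?vg"
    by (intro poly_closure.mult poly_closure.weaken[OF comm.IH(2)] comm) auto
  from poly_closure.comm[OF comm.IH(1) this]
  have uvg: "poly_closure ?k (\<lambda>t. commutator (?u t) (?vg t))" by simp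
  have wuvg: "poly_closure ?k (\<lambda>t. commutator (?w t) (commutator (?u t) (?vg t)))"
    by (rule poly_closure.weaken[OF poly_closure.comm[OF w uvg]]) simp
  show ?case unfolding diff_w by (intro poly_closure.mult ufv fv uvw wuvg uvg)
qed

lemma poly_closure_imp_filtered_poly: "poly_closure k f \<Longrightarrow> filtered_poly k f"
proof (coinduction arbitrary: k f)
  case filtered_poly
  note left = poly_closure_left_diff[OF filtered_poly]
  note right = poly_closure_right_diff[OF filtered_poly left]
  show ?case
    by (simp add: poly_closure_values[OF filtered_poly] left right)
qed

theorem filtered_poly_mult:
  "filtered_poly k f \<Longrightarrow> filtered_poly k g \<Longrightarrow> filtered_poly k (\<lambda>t. f t \<otimes> g t)"
  by (rule poly_closure_imp_filtered_poly[OF poly_closure.mult[OF poly_closure.base poly_closure.base]])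

lemma filtered_poly_imp_poly_map_le_nat:
  assumes "H (k + n) = {\<one>}" "filtered_poly k f"
  shows "poly_map_le_nat G n f"
  using assms
proof (induction n arbitrary: k f)
  case 0
  then show ?case by (auto elim: filtered_poly.cases)
next
  case (Suc n)
  from Suc.prems(2) show ?case
    by cases (use Suc.IH[of "Suc k"] Suc.prems(1) in auto)
qed

end

section \<open>Polynomial maps into a nilpotent group\<close>

text \<open>
  Because \<open>\<gamma>\<close> starts at index 0, \<open>(i - 1) div D\<close> is one less than the rounded-up quotient
  of \<open>i\<close> by \<open>D\<close>, and subadditivity of rounding up becomes the inequality with \<open>Suc\<close> in the proof.
  At \<open>i = 0\<close> the truncated subtraction gives \<open>H 0 = G\<close>.
\<close>

lemma (in group) lower_central_filtered_group:
  assumes "D > 0"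
  shows "filtered_group G (\<lambda>i. lower_central G ((i - 1) div D))"
proof (intro filtered_group.intro filtered_group_axioms.intro)
  show "group G" by (rule is_group)
  show "subgroup (lower_central G ((i - 1) div D)) G" for i by (rule lower_central_subgroup)
  show "lower_central G ((j - 1) div D) \<subseteq> lower_central G ((i - 1) div D)" if "i \<le> j" for i j
    using that by (intro lower_central_antimono div_le_mono) simp
  fix x y i j
  assume xy: "x \<in> lower_central G ((i - 1) div D)" "y \<in> lower_central G ((j - 1) div D)"
  have "(i + j - 1) div D \<le> Suc ((i - 1) div D + (j - 1) div D)"
  proof -
    have "i - 1 < D * Suc ((i - 1) div D)" "j - 1 < D * Suc ((j - 1) div D)"
      using assms by (simp_all add: dividend_less_times_div)
    then have "i + j - 1 < D * Suc (Suc ((i - 1) div D + (j - 1) div D))"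
      using assms by (simp add: algebra_simps)
    then show ?thesis using assms by (simp add: less_mult_imp_div_less mult.commute less_Suc_eq_le[symmetric] del: mult_Suc mult_Suc_right)
  qed
  from lower_central_antimono[OF this] lower_central_commutator[OF xy]
  show "commutator x y \<in> lower_central G ((i + j - 1) div D)" by blast
qed

lemma (in filtered_group) filtered_poly_one: "filtered_poly k (\<lambda>_. \<one>)"
  by (coinduction arbitrary: k)
    (simp add: subgroup.one_closed[OF H_subgroup] left_diff_def right_diff_def)

text \<open>
  This is how an ordinary degree bound enters a filtration whose terms up to \<open>D\<close> are the whole
  group: the first \<open>D\<close> differences satisfy no condition beyond closedness, and the later ones
  are trivial. The bound \<open>k + e \<le> D\<close> ensures that the level has not passed \<open>D\<close> when the map
  has become constant, since from then on all differences are \<open>\<one>\<close>.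
\<close>

lemma (in filtered_group) poly_map_le_nat_imp_filtered_poly:
  assumes H: "\<And>i. i \<le> D \<Longrightarrow> H i = carrier G"
    and f: "\<And>t. f t \<in> carrier G" "poly_map_le_nat G e f" "k + e \<le> D"
  shows "filtered_poly k f"
  using f
proof (coinduction arbitrary: k f e)
  case filtered_poly
  then have f: "\<And>t. f t \<in> carrier G" "poly_map_le_nat G e f" "k + e \<le> D" by auto
  have in_H: "f t \<in> H k" for t using f H[of k] by simp
  show ?case
  proof (cases e)
    case 0
    then obtain c where "\<And>t. f t = c" using f(2) by auto
    then have "left_diff G s f = (\<lambda>_. \<one>)" "right_diff G s f = (\<lambda>_. \<one>)" for s
      using f(1) by (auto simp: left_diff_def right_diff_def fun_eq_iff)
    then show ?thesis using in_H by (simp add: filtered_poly_one)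
  next
    case (Suc e')
    have "left_diff G s f t \<in> carrier G" "right_diff G s f t \<in> carrier G" for s t
      using f(1) by (simp_all add: left_diff_def right_diff_def)
    moreover have "poly_map_le_nat G e' (left_diff G s f)" "poly_map_le_nat G e' (right_diff G s f)" for s
      using f(2) Suc by simp_all
    moreover have "Suc k + e' \<le> D" using f(3) Suc by simp
    ultimately show ?thesis using in_H by blast
  qed
qed

theorem (in group) poly_map_le_nat_mult_nilpotent:
  assumes "lower_central G c = {\<one>}"
    and f: "\<And>t. f t \<in> carrier G" "poly_map_le_nat G d f"
    and g: "\<And>t. g t \<in> carrier G" "poly_map_le_nat G e g"
  shows "poly_map_le_nat G (Suc (Suc (d + e) * c)) (\<lambda>t. f t \<otimes> g t)"
proof -
  \<comment> \<open>\<open>Suc (d + e)\<close> bounds both degrees and is positive even for two constant maps.\<close>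
  interpret F: filtered_group G "\<lambda>i. lower_central G ((i - 1) div Suc (d + e))"
    by (rule lower_central_filtered_group) simp
  have low: "lower_central G ((i - 1) div Suc (d + e)) = carrier G" if "i \<le> Suc (d + e)" for i
    using that by simp
  have bounds: "0 + d \<le> Suc (d + e)" "0 + e \<le> Suc (d + e)" by linarith+
  have "F.filtered_poly 0 f"
    by (rule F.poly_map_le_nat_imp_filtered_poly[OF low f bounds(1)])
  moreover have "F.filtered_poly 0 g"
    by (rule F.poly_map_le_nat_imp_filtered_poly[OF low g bounds(2)])
  ultimately have "F.filtered_poly 0 (\<lambda>t. f t \<otimes> g t)" by (rule F.filtered_poly_mult)
  moreover have "lower_central G ((0 + Suc (Suc (d + e) * c) - 1) div Suc (d + e)) = {\<one>}"
    using assms(1) by (simp only: add_0 diff_Suc_1 nonzero_mult_div_cancel_left)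
  ultimately show ?thesis by (intro F.filtered_poly_imp_poly_map_le_nat)
qed

text \<open>
  Nilpotency is assumed only for the subgroup generated by the values, so degrees have to be
  moved between the group and this subgroup.
\<close>

lemma (in group) poly_map_le_nat_subgroup:
  assumes "subgroup K G" "\<And>t. f t \<in> K"
  shows "poly_map_le_nat (G\<lparr>carrier := K\<rparr>) n f \<longleftrightarrow> poly_map_le_nat G n f"
  using assms(2)
proof (induction n arbitrary: f)
  case 0
  then show ?case by simp
next
  case (Suc n)
  have "left_diff (G\<lparr>carrier := K\<rparr>) s f = left_diff G s f"
    "right_diff (G\<lparr>carrier := K\<rparr>) s f = right_diff G s f" for s
    using Suc.prems assms(1) by (simp_all add: left_diff_def right_diff_def m_inv_consistent)
  moreover have "left_diff G s f t \<in> K" "right_diff G s f t \<in> K" for s t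
    using Suc.prems assms(1)
    by (simp_all add: left_diff_def right_diff_def subgroup.m_closed subgroup.m_inv_closed)
  ultimately show ?case using Suc.IH by simp
qed

lemma poly_map_le_imp_nat:
  assumes "poly_map_le G d f"
  obtains n where "poly_map_le_nat G n f"
proof (cases d)
  case MInfty
  with assms have "poly_map_le_nat G 0 f" by (auto simp: poly_map_le_def)
  then show ?thesis by (rule that)
next
  case (Deg n)
  with assms show ?thesis by (intro that[of n]) (simp add: poly_map_le_def)
qed

theorem theorem1:
  fixes G :: "('g, 'm) monoid_scheme"
    and f f' :: "'s::ab_semigroup_add \<Rightarrow> 'g"
    and d d' :: degree_bound
  assumes "group G"
    and "poly_map_le G d f"
    and "poly_map_le G d' f'"
    and "nilpotent_group (G\<lparr>carrier := generate G (range f \<union> range f')\<rparr>)"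
  shows "poly_map G (\<lambda>t. f t \<otimes>\<^bsub>G\<^esub> f' t)"
proof -
  interpret group G by fact
  define K where "K = generate G (range f \<union> range f')"
  let ?K = "G\<lparr>carrier := K\<rparr>"
  have "range f \<union> range f' \<subseteq> carrier G" using assms(2,3) by (auto simp: poly_map_le_def)
  then have sub: "subgroup K G" unfolding K_def by (rule generate_is_subgroup)
  have inK: "f t \<in> K" "f' t \<in> K" for t by (auto simp: K_def intro: generate.incl)
  interpret K: group ?K using sub by (rule subgroup_imp_group)
  obtain c where c: "lower_central ?K c = {\<one>\<^bsub>?K\<^esub>}"
    using assms(4) by (auto simp: nilpotent_group_def K_def)
  obtain m m' where "poly_map_le_nat G m f" "poly_map_le_nat G m' f'"
    using poly_map_le_imp_nat[OF assms(2)] poly_map_le_imp_nat[OF assms(3)] by metis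
  then have "poly_map_le_nat ?K m f" "poly_map_le_nat ?K m' f'"
    using poly_map_le_nat_subgroup[OF sub] inK by auto
  then obtain n where "poly_map_le_nat ?K n (\<lambda>t. f t \<otimes>\<^bsub>?K\<^esub> f' t)"
    using K.poly_map_le_nat_mult_nilpotent[OF c, of f m f' m'] inK
    by (simp del: poly_map_le_nat.simps)
  then have "poly_map_le_nat ?K n (\<lambda>t. f t \<otimes>\<^bsub>G\<^esub> f' t)" by simp
  then have "poly_map_le_nat G n (\<lambda>t. f t \<otimes>\<^bsub>G\<^esub> f' t)"
    using poly_map_le_nat_subgroup[OF sub, of "\<lambda>t. f t \<otimes>\<^bsub>G\<^esub> f' t"] inK
      subgroup.m_closed[OF sub] by simp
  moreover have "f t \<otimes>\<^bsub>G\<^esub> f' t \<in> carrier G" for t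
    using inK sub by (meson m_closed subgroup.mem_carrier)
  ultimately have "poly_map_le G (Deg n) (\<lambda>t. f t \<otimes>\<^bsub>G\<^esub> f' t)"
    by (simp add: poly_map_le_def)
  then show ?thesis unfolding poly_map_def by blast
qed

end
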